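(* Let $F \subseteq \mathbb{N}$ be a finite nonempty set with $\min F \geq 3$. Then $Q_{U(F,5)} > 1$.
   Context: For a nonzero integer $N$, $\mathrm{rad}(N)$ denotes the largest square-free positive divisor of $N$. For $a = (a_1,\ldots,a_n) \in \mathbb{Z}^n$ with all $a_i \neq 0$, the quality of $a$ is $q(a) = \frac{\log(\max\{|a_1|,\ldots,|a_n|\})}{\log \mathrm{rad}(a_1 \cdots a_n)}$. For a set $A$ of such $n$-tuples, $Q_A$ denotes the limit superior of $q(a)$ over $a \in A$ (i.e. $\inf_{S \subseteq A \text{ finite}} \sup_{a \in A \setminus S} q(a)$). For a finite set $F \subseteq \mathbb{N}$, $U(F,5)$ is the set of all $(a_1,\ldots,a_5) \in \mathbb{Z}^5$ such that: (i) $\gcd(a_i,a_j) = 1$ for all $1 \leq i < j \leq 5$; (ii) $a_1 + \cdots + a_5 = 0$; (iii) there are no $b_1,\ldots,b_5 \in \{-1,0,1\}$ and indices $i,j$ with $b_i = 0$, $b_j = 1$ and $\sum_{k=1}^5 b_k a_k = 0$; (iv) none of $a_1,\ldots,a_5$ is a multiple of any element of $F$. *)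

theory Defs
  imports Complex_Main "HOL-Library.Extended_Real" "HOL-Computational_Algebra.Squarefree"
begin

definition rad :: "int \<Rightarrow> int" where
  "rad N = Max {d. 0 < d \<and> squarefree d \<and> d dvd N}"

(* Integer n-tuples are lists of length n; the entry a_i of the mathematical text is a ! (i - 1). *)

definition quality :: "int list \<Rightarrow> real" where
  "quality a = ln (real_of_int (Max (abs ` set a))) / ln (real_of_int (rad (prod_list a)))"

(* Extended-real valued, so that unbounded qualities give \<infinity> and a finite A gives -\<infinity>. *)

definition limsup_quality :: "int list set \<Rightarrow> ereal" where
  "limsup_quality A = (INF S\<in>{S. finite S \<and> S \<subseteq> A}. SUP a\<in>A - S. ereal (quality a))"

definition U :: "nat set \<Rightarrow> nat \<Rightarrow> int list set" where
  "U F n = {a. length a = n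
     \<and> (\<forall>i j. i < j \<and> j < n \<longrightarrow> gcd (a ! i) (a ! j) = 1)
     \<and> (\<Sum>k<n. a ! k) = 0
     \<and> \<not> (\<exists>b :: nat \<Rightarrow> int. (\<forall>k<n. b k \<in> {-1, 0, 1})
            \<and> (\<exists>i<n. \<exists>j<n. b i = 0 \<and> b j = 1)
            \<and> (\<Sum>k<n. b k * a ! k) = 0)
     \<and> (\<forall>k<n. \<forall>f\<in>F. \<not> int f dvd a ! k)}"

(* The qualities of elements of U F n are meaningful: no entry vanishes. *)

lemma U_nth_nonzero:
  assumes a: "a \<in> U F n" and n: "2 \<le> n" and i: "i < n"
  shows "a ! i \<noteq> 0"
proof
  assume 0: "a ! i = 0"
  define b :: "nat \<Rightarrow> int" where "b k = (if k = i then 1 else 0)" for k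
  define j :: nat where "j = (if i = 0 then 1 else 0)"
  have "j < n" "b j = 0" "b i = 1" using n by (auto simp: b_def j_def)
  moreover have "\<forall>k<n. b k \<in> {-1, 0, 1}" by (simp add: b_def)
  moreover have "(\<Sum>k<n. b k * a ! k) = 0"
    by (intro sum.neutral) (simp add: b_def 0)
  ultimately show False using a i unfolding U_def by blast
qed

end

theory Submission
  imports Defs "HOL-Number_Theory.Cong"
begin

text \<open>
  Every element of \<open>F\<close> is divisible by 4 or shares a nontrivial factor with a fixed odd number \<open>P\<close>.
  For \<open>n = 6 * P - 1\<close>, \<open>j = (n - 1) div 2\<close> and \<open>3 * \<beta> = n - 2\<close> the two leading coefficients (in powers
  of \<open>(x - 1)\<^sup>2\<close>) of \<open>x ^ n - (x - 2) ^ n - 2 * n * ((x - 1)\<^sup>2 + \<beta>) ^ j\<close> cancel, so this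
  polynomial has degree at most \<open>n - 5\<close>. Its three terms, a constant \<open>c\<close>, and the negative \<open>w\<close> of the
  sum of these four form a zero sum of five numbers. When \<open>x\<close> runs through powers of a fixed \<open>g\<close>, the
  radical of the product is \<open>O(x ^ (1 + 2 + (n - 5)))\<close> while the maximum is at least \<open>x ^ n\<close>, so the
  quality is eventually at least \<open>n / (n - 1)\<close>. Choosing \<open>g\<close> congruent to 1 modulo a suitable \<open>N\<close>
  makes the five numbers pairwise coprime, coprime to \<open>P\<close> and not divisible by 4. A vanishing signed
  subsum is excluded because the terms have different orders of magnitude and \<open>w\<close>, \<open>c\<close> are coprime.
\<close>

section \<open>Radicals and prime divisors\<close>

lemma squarefree_dvd_if_prime_factors_dvd:
  fixes d m :: int
  assumes "squarefree d" and "\<And>p. prime p \<Longrightarrow> p dvd d \<Longrightarrow> p dvd m"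
  shows "d dvd m"
proof (cases "m = 0")
  case False
  have d: "d \<noteq> 0" using assms(1) by auto
  show ?thesis
  proof (rule multiplicity_le_imp_dvd[OF d])
    fix p :: int assume p: "prime p"
    show "multiplicity p d \<le> multiplicity p m"
    proof (cases "p dvd d")
      case True
      have "multiplicity p d = 1"
        using assms(1) d p True by (auto simp: prime_factors_dvd squarefree_factorial_semiring')
      moreover have "multiplicity p m \<ge> 1"
        using assms(2)[OF p True] p False
        by (metis One_nat_def Suc_leI not_dvd_imp_multiplicity_0 multiplicity_gt_zero_iff not_prime_unit)
      ultimately show ?thesis by simp
    qed (simp add: not_dvd_imp_multiplicity_0)
  qed
qed auto

lemma rad_properties:
  assumes "N \<noteq> 0"
  shows "0 < rad N" "squarefree (rad N)" "rad N dvd N"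
    and "0 < d \<Longrightarrow> squarefree d \<Longrightarrow> d dvd N \<Longrightarrow> d \<le> rad N"
proof -
  let ?D = "{d. 0 < d \<and> squarefree d \<and> d dvd N}"
  have "d \<in> {1..\<bar>N\<bar>}" if "d \<in> ?D" for d
    using that dvd_imp_le_int[OF assms, of d] by auto
  hence "?D \<subseteq> {1..\<bar>N\<bar>}" by blast
  hence fin: "finite ?D" using finite_subset by blast
  have "1 \<in> ?D" by simp
  hence "rad N \<in> ?D" unfolding rad_def using Max_in[OF fin] by blast
  thus "0 < rad N" "squarefree (rad N)" "rad N dvd N" by auto
  show "0 < d \<Longrightarrow> squarefree d \<Longrightarrow> d dvd N \<Longrightarrow> d \<le> rad N"
    unfolding rad_def by (rule Max_ge[OF fin]) simp
qed

text \<open>Being squarefree, \<open>rad N\<close> divides any \<open>M\<close> that contains its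
  primes. So \<open>M\<close> may be built from the bases of the powers that occur in
  \<open>N\<close>, which is what keeps the radical small.\<close>

lemma rad_le:
  fixes N M :: int
  assumes "N \<noteq> 0" "M \<noteq> 0" "\<And>p. prime p \<Longrightarrow> p dvd N \<Longrightarrow> p dvd M"
  shows "rad N \<le> \<bar>M\<bar>"
proof -
  have "rad N dvd M"
    using rad_properties(2)[OF assms(1)]
  proof (rule squarefree_dvd_if_prime_factors_dvd)
    fix p assume "prime p" "p dvd rad N"
    thus "p dvd M" using assms(3) dvd_trans[OF _ rad_properties(3)[OF assms(1)]] by blast
  qed
  hence "\<bar>rad N\<bar> \<le> \<bar>M\<bar>" by (rule dvd_imp_le_int[OF assms(2)])
  thus ?thesis by simp
qed

section \<open>A membership criterion for \<open>U F 5\<close>\<close>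

lemma all_less_5: "(\<forall>k<5::nat. Q k) \<longleftrightarrow> Q 0 \<and> Q 1 \<and> Q 2 \<and> Q 3 \<and> Q 4"
  by (auto simp: numeral_eq_Suc less_Suc_eq)

lemma sum_less_5: "(\<Sum>k<5::nat. f k) = f 0 + f 1 + f 2 + f 3 + (f 4 :: int)"
  by (simp add: numeral_eq_Suc)

lemma all_pairs_less_5:
  "(\<forall>i j. i < j \<and> j < (5::nat) \<longrightarrow> R i j) \<longleftrightarrow>
    R 0 1 \<and> R 0 2 \<and> R 0 3 \<and> R 0 4 \<and> R 1 2 \<and> R 1 3 \<and> R 1 4 \<and> R 2 3 \<and> R 2 4 \<and> R 3 4"
  by (auto simp: numeral_eq_Suc less_Suc_eq)

text \<open>Subtracting \<open>b1\<close> times the zero sum removes \<open>a2\<close> and leaves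
  coefficients of size at most 2. The size gaps force those of \<open>a1\<close> and then
  \<open>a3\<close> to vanish; by coprimality \<open>a5\<close> divides \<open>b3 - b1\<close>,
  which is too small to be nonzero. Equal coefficients cannot include both 0 and 1.\<close>

lemma signed_subsum_trivial:
  fixes a1 a2 a3 a4 a5 b0 b1 b2 b3 b4 :: int
  assumes b: "\<bar>b0\<bar> \<le> 1" "\<bar>b1\<bar> \<le> 1" "\<bar>b2\<bar> \<le> 1" "\<bar>b3\<bar> \<le> 1" "\<bar>b4\<bar> \<le> 1"
    and sum0: "a1 + a2 + a3 + a4 + a5 = 0"
    and bsum: "b0 * a1 + b1 * a2 + b2 * a3 + b3 * a4 + b4 * a5 = 0"
    and cop: "coprime a4 a5"
    and s1: "2 * (\<bar>a3\<bar> + \<bar>a4\<bar> + \<bar>a5\<bar>) < \<bar>a1\<bar>"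
    and s3: "2 * (\<bar>a4\<bar> + \<bar>a5\<bar>) < \<bar>a3\<bar>" and s5: "3 \<le> \<bar>a5\<bar>"
  shows "b0 = b1 \<and> b2 = b1 \<and> b3 = b1 \<and> b4 = b1"
proof -
  have small: "\<bar>d * z\<bar> \<le> 2 * \<bar>z\<bar>" if "\<bar>d\<bar> \<le> 2" for d z :: int
    using mult_right_mono[OF that, of "\<bar>z\<bar>"] by (simp add: abs_mult)
  have big: "\<bar>z\<bar> \<le> \<bar>d * z\<bar>" if "d \<noteq> 0" for d z :: int
    using mult_right_mono[of 1 "\<bar>d\<bar>" "\<bar>z\<bar>"] that by (simp add: abs_mult)
  have dom: "\<bar>p\<bar> \<le> \<bar>q\<bar> + \<bar>r\<bar> + \<bar>s\<bar>" if "p + q + r + s = 0" for p q r s :: int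
    using that by linarith
  have a2: "a2 = - (a1 + a3 + a4 + a5)" using sum0 by linarith
  have eq: "(b0 - b1) * a1 + (b2 - b1) * a3 + (b3 - b1) * a4 + (b4 - b1) * a5 = 0"
    using bsum unfolding a2 by (simp add: algebra_simps)
  have d: "\<bar>b2 - b1\<bar> \<le> 2" "\<bar>b3 - b1\<bar> \<le> 2" "\<bar>b4 - b1\<bar> \<le> 2" using b by linarith+
  note sm = small[OF d(1), of a3] small[OF d(2), of a4] small[OF d(3), of a5]
  have e0: "b0 = b1"
  proof (rule ccontr)
    assume "b0 \<noteq> b1"
    hence "\<bar>a1\<bar> \<le> \<bar>(b0 - b1) * a1\<bar>" by (intro big) simp
    also have "\<dots> \<le> \<bar>(b2 - b1) * a3\<bar> + \<bar>(b3 - b1) * a4\<bar> + \<bar>(b4 - b1) * a5\<bar>"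
      by (rule dom[OF eq])
    also have "\<dots> \<le> 2 * \<bar>a3\<bar> + 2 * \<bar>a4\<bar> + 2 * \<bar>a5\<bar>" by (intro add_mono sm)
    also have "\<dots> < \<bar>a1\<bar>" using s1 by simp
    finally show False by simp
  qed
  have e2: "b2 = b1"
  proof (rule ccontr)
    assume "b2 \<noteq> b1"
    hence "\<bar>a3\<bar> \<le> \<bar>(b2 - b1) * a3\<bar>" by (intro big) simp
    also have "\<dots> \<le> \<bar>(b3 - b1) * a4\<bar> + \<bar>(b4 - b1) * a5\<bar> + \<bar>0\<bar>"
      using eq e0 by (intro dom) simp
    also have "\<dots> \<le> 2 * \<bar>a4\<bar> + 2 * \<bar>a5\<bar> + 0" by (intro add_mono sm) simp
    also have "\<dots> < \<bar>a3\<bar>" using s3 by simp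
    finally show False by simp
  qed
  have eq4: "(b3 - b1) * a4 = - (b4 - b1) * a5" using eq e0 e2 by (simp add: algebra_simps)
  hence "a5 dvd (b3 - b1) * a4" by simp
  hence "a5 dvd b3 - b1" using cop by (simp add: coprime_dvd_mult_left_iff coprime_commute)
  hence e3: "b3 = b1" using d(2) s5 dvd_imp_le_int[of "b3 - b1" a5] by fastforce
  hence "b4 = b1" using eq4 s5 by auto
  thus ?thesis using e0 e2 e3 by simp
qed

lemma in_U_5I:
  fixes a1 a2 a3 a4 a5 :: int
  assumes cop: "coprime a1 a2" "coprime a1 a3" "coprime a1 a4" "coprime a1 a5" "coprime a2 a3"
      "coprime a2 a4" "coprime a2 a5" "coprime a3 a4" "coprime a3 a5" "coprime a4 a5"
    and sum0: "a1 + a2 + a3 + a4 + a5 = 0"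
    and s1: "2 * (\<bar>a3\<bar> + \<bar>a4\<bar> + \<bar>a5\<bar>) < \<bar>a1\<bar>"
    and s3: "2 * (\<bar>a4\<bar> + \<bar>a5\<bar>) < \<bar>a3\<bar>" and s5: "3 \<le> \<bar>a5\<bar>"
    and F: "\<And>f z. f \<in> F \<Longrightarrow> z \<in> {a1, a2, a3, a4, a5} \<Longrightarrow> \<not> int f dvd z"
  shows "[a1, a2, a3, a4, a5] \<in> U F 5"
proof -
  let ?a = "[a1, a2, a3, a4, a5]"
  have "\<not> (\<exists>b :: nat \<Rightarrow> int. (\<forall>k<5. b k \<in> {-1, 0, 1})
            \<and> (\<exists>i<5. \<exists>j<5. b i = 0 \<and> b j = 1) \<and> (\<Sum>k<5. b k * ?a ! k) = 0)"
  proof clarify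
    fix b :: "nat \<Rightarrow> int" and i j :: nat
    assume b: "\<forall>k<5. b k \<in> {-1, 0, 1}" and ij: "i < 5" "j < 5" "b i = 0" "b j = 1"
      and s: "(\<Sum>k<5. b k * ?a ! k) = 0"
    have "\<forall>k<5. \<bar>b k\<bar> \<le> 1" using b by fastforce
    hence "b 0 = b 1 \<and> b 2 = b 1 \<and> b 3 = b 1 \<and> b 4 = b 1"
      using s cop(10) sum0 s1 s3 s5 unfolding all_less_5 sum_less_5
      by (intro signed_subsum_trivial[of _ _ _ _ _ a1 a2 a3 a4 a5]) simp_all
    hence "\<forall>k<5. b k = b 1" by (simp add: all_less_5)
    thus False using ij by (metis zero_neq_one)
  qed
  thus ?thesis
    unfolding U_def mem_Collect_eq all_pairs_less_5 sum_less_5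
    using cop sum0 F by (simp add: all_less_5 coprime_iff_gcd_eq_1)
qed

section \<open>Binomial expansions\<close>

lemma sum_even_odd_split: "(\<Sum>k\<le>2 * j + 1. f k) = (\<Sum>i\<le>j. f (2 * i) + f (2 * i + 1 :: nat) :: int)"
proof (induction j)
  case (Suc j)
  have "2 * Suc j + 1 = Suc (Suc (2 * j + 1))" by simp
  thus ?case using Suc by (simp only: sum.atMost_Suc) simp
qed simp

text \<open>The exponent is odd, so odd powers of \<open>u\<close> cancel and even powers double:
  the difference is a polynomial in \<open>u\<^sup>2\<close>.\<close>

lemma odd_power_diff:
  fixes u :: int
  shows "(u + 1) ^ (2 * j + 1) - (u - 1) ^ (2 * j + 1)
    = 2 * (\<Sum>i\<le>j. int ((2 * j + 1) choose (2 * i)) * (u\<^sup>2) ^ i)"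
proof -
  let ?n = "2 * j + 1"
  have "(u + 1) ^ ?n - (u - 1) ^ ?n
      = (\<Sum>k\<le>?n. int (?n choose k) * u ^ k * (1 - (- 1) ^ (?n - k)))"
    using binomial_ring[of u 1 ?n] binomial_ring[of u "- 1" ?n]
    by (simp add: sum_subtractf[symmetric] right_diff_distrib)
  also have "\<dots> = (\<Sum>i\<le>j. 2 * (int (?n choose (2 * i)) * (u\<^sup>2) ^ i))"
    unfolding sum_even_odd_split
    by (intro sum.cong refl) (auto simp: power_mult uminus_power_if)
  finally show ?thesis by (simp add: sum_distrib_left)
qed

lemma power_sum_bound:
  fixes t :: "nat \<Rightarrow> int"
  assumes "v \<ge> 1"
  shows "\<bar>\<Sum>i\<le>m. t i * v ^ i\<bar> \<le> (\<Sum>i\<le>m. \<bar>t i\<bar>) * v ^ m"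
proof -
  have "\<bar>\<Sum>i\<le>m. t i * v ^ i\<bar> \<le> (\<Sum>i\<le>m. \<bar>t i * v ^ i\<bar>)" by (rule sum_abs)
  also have "\<dots> \<le> (\<Sum>i\<le>m. \<bar>t i\<bar> * v ^ m)"
    using assms by (intro sum_mono) (auto simp: abs_mult intro!: mult_left_mono power_increasing)
  finally show ?thesis by (simp add: sum_distrib_right)
qed

section \<open>Parameters, polynomials and their residues\<close>

locale coprime_family =
  fixes P :: nat
  assumes odd_P: "odd P"
begin

text \<open>With \<open>n = 6 * P - 1\<close> the number \<open>n - 2\<close> is a multiple of 3, so
  \<beta> is an integer. Moreover \<open>n\<close> and \<beta> are both -1 modulo \<open>P\<close>,
  and \<open>j\<close> is even because \<open>P\<close> is odd.\<close>

definition j :: nat where "j = 3 * P - 1"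
definition n :: nat where "n = 2 * j + 1"
definition \<beta> :: int where "\<beta> = 2 * int P - 1"
definition S :: "int \<Rightarrow> int" where "S v = (\<Sum>i\<le>j. int (n choose (2 * i)) * v ^ i)"
text \<open>Half of \<open>w 1 + c\<close>: modulo divisors of \<open>N\<close>, where
  \<open>x\<close> is 1, the value \<open>w x\<close> becomes \<open>2 * D - c\<close>.\<close>

definition D :: int where "D = int n * \<beta> ^ j - 1"
text \<open>
  Solves \<open>c = - 1\<close> modulo \<open>n * \<beta> * D\<close> and \<open>c = - 2\<close> modulo \<open>P\<close>, where \<open>n * \<beta> * D = - 2\<close> modulo \<open>P\<close>.
\<close>
definition c :: int where "c = int n * \<beta> * D * ((int P + 1) div 2) - 1"
text \<open>
  \<open>- K1\<close> is the residue of \<open>w x\<close> modulo \<open>x\<close> and modulo \<open>x - 2\<close>, and \<open>- K2\<close> that modulo \<open>q x\<close>.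
\<close>
definition K1 :: int where "K1 = 2 ^ n - 2 * int n * (2 * int P) ^ j + c"
definition K2 :: int where "K2 = 2 * S (- \<beta>) + c"
text \<open>Collects the fixed numbers to which the entries must be made coprime by fixing the
  residue of \<open>x\<close>; \<open>K1\<close> and \<open>K2\<close> enter as residues of
  \<open>w x\<close>.\<close>

definition N :: int where "N = 2 * int P * int n * c * K1 * K2"
definition q :: "int \<Rightarrow> int" where "q x = (x - 1)\<^sup>2 + \<beta>"
definition w :: "int \<Rightarrow> int" where "w x = - (x ^ n - (x - 2) ^ n - 2 * int n * q x ^ j + c)"

lemma P_pos: "P \<ge> 1" using odd_P by (cases P) auto

lemma j_ge: "j \<ge> 2" using P_pos by (simp add: j_def)

lemma n_beta: "int n = 3 * \<beta> + 2"
  using P_pos by (simp add: n_def j_def \<beta>_def)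

lemma n_P: "int n = 6 * int P - 1"
  using n_beta by (simp add: \<beta>_def)

lemma beta_pos: "\<beta> \<ge> 1" using P_pos by (simp add: \<beta>_def)

lemma odd_beta: "odd \<beta>" by (simp add: \<beta>_def)

lemma odd_n: "odd n" by (simp add: n_def)

lemma even_j: "even j" using odd_P P_pos by (simp add: j_def)

lemma n_ge: "n \<ge> 5" using j_ge by (simp add: n_def)

lemma even_D: "even D" using odd_n odd_beta by (simp add: D_def)

lemma D_ge: "D \<ge> 4"
  using mult_mono[of 5 "int n" 1 "\<beta> ^ j"] n_ge beta_pos by (simp add: D_def)

lemma odd_c: "odd c" using even_D by (simp add: c_def)

lemma c_ge: "c \<ge> 3"
proof -
  have "1 \<le> int n * \<beta>" using mult_mono[of 1 "int n" 1 \<beta>] n_ge beta_pos by simp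
  hence "4 \<le> int n * \<beta> * D" using mult_mono[of 1 "int n * \<beta>" 4 D] D_ge by simp
  moreover have "1 \<le> (int P + 1) div 2" using P_pos by simp
  ultimately have "4 * 1 \<le> int n * \<beta> * D * ((int P + 1) div 2)"
    by (intro mult_mono) auto
  thus ?thesis by (simp add: c_def)
qed

lemma odd_K1: "odd K1" using odd_c n_ge by (simp add: K1_def)

lemma odd_K2: "odd K2" using odd_c by (simp add: K2_def)

lemma N_nonzero: "N \<noteq> 0"
  using odd_K1 odd_K2 odd_c P_pos n_ge by (auto simp: N_def)

lemma S_eq: "x ^ n - (x - 2) ^ n = 2 * S ((x - 1)\<^sup>2)"
  using odd_power_diff[of "x - 1" j] by (simp add: S_def n_def)

lemma S_cong: "[v = v'] (mod m) \<Longrightarrow> [S v = S v'] (mod m)"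
  unfolding S_def by (intro cong_sum cong_mult cong_pow cong_refl)

lemma q_cong: "[x = x'] (mod m) \<Longrightarrow> [q x = q x'] (mod m)"
  unfolding q_def by (intro cong_add cong_pow cong_diff cong_refl)

lemma w_cong: "[x = x'] (mod m) \<Longrightarrow> [w x = w x'] (mod m)"
  unfolding w_def
  by (intro cong_uminus cong_add cong_mult cong_pow cong_diff cong_refl q_cong)

lemma q_1: "q 1 = \<beta>" by (simp add: q_def)

text \<open>Since \<open>n\<close> is odd and \<open>q 0 = q 2\<close>, the values of
  \<open>w\<close> at 0 and 2 coincide, so one constant serves both moduli \<open>x\<close> and
  \<open>x - 2\<close>.\<close>

lemma w_0: "w 0 = - K1"
  using odd_n n_ge by (simp add: w_def K1_def q_def \<beta>_def)

lemma w_2: "w 2 = - K1"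
  using n_ge by (simp add: w_def K1_def q_def \<beta>_def)

lemma w_1: "w 1 = 2 * D - c"
  using odd_n by (simp add: w_def D_def q_1)

text \<open>Modulo \<open>q x\<close> the square \<open>(x - 1)\<^sup>2\<close> is - \<beta>, and
  the term with \<open>q x ^ j\<close> vanishes.\<close>

lemma w_mod_q: "[w x = - K2] (mod q x)"
proof -
  have "[(x - 1)\<^sup>2 = - \<beta>] (mod q x)" by (simp add: cong_iff_dvd_diff q_def)
  hence "[S ((x - 1)\<^sup>2) = S (- \<beta>)] (mod q x)" by (rule S_cong)
  moreover have "[q x ^ j = 0] (mod q x)" using j_ge by (simp add: cong_0_iff)
  ultimately have "[- (2 * S ((x - 1)\<^sup>2) - 2 * int n * q x ^ j + c)
      = - (2 * S (- \<beta>) - 2 * int n * 0 + c)] (mod q x)"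
    by (intro cong_uminus cong_add cong_mult cong_diff cong_refl)
  thus ?thesis unfolding w_def S_eq K2_def by simp
qed

text \<open>Modulo any divisor of the product of \<open>n\<close>, \<beta> and \<open>D\<close>,
  \<open>c\<close> is -1 and \<open>c + 2\<close> is 1. The latter is needed because
  \<open>w 1\<close> is \<open>- (c + 2)\<close> modulo \<open>n\<close> and \<open>K2\<close> is
  \<open>c + 2\<close> modulo \<beta>.\<close>

lemma coprime_c: "coprime c (int n)" "coprime c \<beta>" "coprime c D"
    "coprime (c + 2) (int n)" "coprime (c + 2) \<beta>"
proof -
  have *: "coprime c m" "coprime (c + 2) m" if "m dvd int n * \<beta> * D" for m
  proof -
    have "[c = - 1] (mod m)" using that by (simp add: cong_iff_dvd_diff c_def)
    hence "[- 1 = c] (mod m)" by (rule cong_sym)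
    moreover from this have "[- 1 + 2 = c + 2] (mod m)" by (rule cong_add) simp
    ultimately show "coprime c m" "coprime (c + 2) m" by (auto elim!: cong_imp_coprime)
  qed
  show "coprime c (int n)" "coprime c \<beta>" "coprime c D"
    "coprime (c + 2) (int n)" "coprime (c + 2) \<beta>" by (auto intro!: *)
qed

lemma n_mod_P: "[int n = - 1] (mod int P)"
  unfolding n_P by (simp add: cong_iff_dvd_diff)

lemma beta_mod_P: "[\<beta> = - 1] (mod int P)"
  unfolding \<beta>_def by (simp add: cong_iff_dvd_diff)

lemma D_mod_P: "[D = - 2] (mod int P)"
proof -
  have "[D = - 1 * (- 1) ^ j - 1] (mod int P)" unfolding D_def
    by (intro cong_diff cong_mult cong_pow n_mod_P beta_mod_P cong_refl)
  thus ?thesis using even_j by simp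
qed

text \<open>The residue -2 turns \<open>2 * D - c\<close> into -2, a unit modulo the odd number
  \<open>P\<close>. With \<open>c\<close> equal to -1 it would be -3, which may share the factor 3
  with \<open>P\<close>.\<close>

lemma c_mod_P: "[c = - 2] (mod int P)"
proof -
  have "[int n * \<beta> * D * ((int P + 1) div 2) - 1 = - 1 * - 1 * - 2 * ((int P + 1) div 2) - 1] (mod int P)"
    by (intro cong_diff cong_mult n_mod_P beta_mod_P D_mod_P cong_refl)
  moreover have "2 * ((int P + 1) div 2) = int P + 1" using odd_P by (intro dvd_mult_div_cancel) simp
  ultimately have "[c = - (int P + 1) - 1] (mod int P)" unfolding c_def by (simp add: mult.assoc)
  moreover have "[- (int P + 1) - 1 = - 2] (mod int P)" by (simp add: cong_iff_dvd_diff)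
  ultimately show ?thesis by (rule cong_trans)
qed

lemma coprime_mod_P: "[z = s] (mod int P) \<Longrightarrow> s \<in> {1, - 1, 2, - 2} \<Longrightarrow> coprime z (int P)"
  using odd_P by (intro cong_imp_coprime[OF cong_sym, of z s]) auto

text \<open>Only the constant term 1 of \<open>S\<close> survives modulo \<beta>.\<close>

lemma K2_mod_beta: "[K2 = c + 2] (mod \<beta>)"
proof -
  have "[S (- \<beta>) = S 0] (mod \<beta>)" by (intro S_cong) (simp add: cong_iff_dvd_diff)
  moreover have "S 0 = 1" by (simp add: S_def power_0_left if_distrib cong: if_cong)
  ultimately have "[2 * S (- \<beta>) + c = 2 * 1 + c] (mod \<beta>)"
    by (intro cong_add cong_mult cong_refl) auto
  thus ?thesis by (simp add: K2_def add.commute)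
qed

section \<open>Cancellation of leading terms and growth of \<open>w\<close>\<close>

definition C :: int where
  "C = (\<Sum>i\<le>j - 2. \<bar>2 * (int (n choose (2 * i)) - int n * int (j choose i) * \<beta> ^ (j - i))\<bar>) + c"

text \<open>The reason for \<open>3 * \<beta> = n - 2\<close>: the two sides are the coefficients of
  \<open>v ^ (j - 1)\<close> in \<open>S v\<close> and in
  \<open>n * (v + \<beta>) ^ j\<close>.\<close>

lemma three_binomial: "int (n choose 3) = int n * int j * \<beta>"
proof -
  have "3 * (n choose 3) = n * ((n - 1) choose 2)"
    using binomial_absorption[of 2 n] by (simp add: numeral_eq_Suc)
  moreover have "2 * ((n - 1) choose 2) = (n - 1) * (n - 2)"
    using binomial_absorption[of 1 "n - 1"] by (simp add: numeral_eq_Suc)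
  ultimately have "6 * (n choose 3) = n * ((n - 1) * (n - 2))"
    by (metis mult.assoc mult.left_commute numeral_times_numeral semiring_norm(12,14))
  hence "6 * int (n choose 3) = int n * (int (n - 1) * int (n - 2))"
    by (metis of_nat_mult of_nat_numeral)
  hence "6 * int (n choose 3) = int n * (int n - 1) * (int n - 2)"
    using n_ge by (simp add: of_nat_diff)
  also have "\<dots> = int n * (2 * int j) * (3 * \<beta>)" using n_beta by (simp add: n_def)
  finally show ?thesis by simp
qed

lemma w_bound:
  assumes "x \<ge> 2"
  shows "\<bar>w x\<bar> \<le> C * (x - 1) ^ (n - 5)"
proof -
  define v where "v = (x - 1)\<^sup>2"
  define t where "t i = 2 * (int (n choose (2 * i)) - int n * int (j choose i) * \<beta> ^ (j - i))" for i
  have v: "v \<ge> 1" using assms by (simp add: v_def)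
  have "(v + \<beta>) ^ j = (\<Sum>i\<le>j. int (j choose i) * v ^ i * \<beta> ^ (j - i))"
    by (simp add: binomial_ring)
  hence "2 * S v - 2 * int n * q x ^ j = (\<Sum>i\<le>j. t i * v ^ i)"
    unfolding q_def v_def[symmetric] S_def t_def
    by (simp add: sum_distrib_left sum_subtractf algebra_simps)
  also have "\<dots> = (\<Sum>i\<le>j - 2. t i * v ^ i)"
  proof -
    have jj: "{..j} = {..Suc (Suc (j - 2))}" using j_ge by simp
    have j: "Suc (j - 2) = j - 1" "Suc (j - 1) = j" using j_ge by auto
    \<comment> \<open>In degree \<open>j\<close> both polynomials have coefficient
      \<open>2 * n\<close>; degree \<open>j - 1\<close> is settled by
      \<open>three_binomial\<close>.\<close>
    have "n choose (2 * j) = n" by (simp add: n_def)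
    hence 1: "t j = 0" by (simp add: t_def)
    have "n choose (2 * (j - 1)) = n choose 3"
    proof -
      have "n - 2 * (j - 1) = 3" "2 * (j - 1) \<le> n" using j_ge by (auto simp: n_def)
      thus ?thesis by (metis binomial_symmetric)
    qed
    moreover have "j choose (j - 1) = j"
      using j_ge by (subst binomial_symmetric) auto
    ultimately have 2: "t (j - 1) = 0" using three_binomial j_ge by (simp add: t_def)
    have "t (Suc (j - 2)) = 0" "t (Suc (Suc (j - 2))) = 0" using 1 2 j by simp_all
    thus ?thesis by (simp add: jj)
  qed
  finally have "w x = - ((\<Sum>i\<le>j - 2. t i * v ^ i) + c)"
    unfolding w_def S_eq v_def[symmetric] by simp
  hence "\<bar>w x\<bar> \<le> \<bar>\<Sum>i\<le>j - 2. t i * v ^ i\<bar> + c" using c_ge by simp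
  also have "\<dots> \<le> (\<Sum>i\<le>j - 2. \<bar>t i\<bar>) * v ^ (j - 2) + c * v ^ (j - 2)"
  proof (rule add_mono)
    show "c \<le> c * v ^ (j - 2)"
      using mult_left_mono[of 1 "v ^ (j - 2)" c] v c_ge by (simp add: one_le_power)
  qed (rule power_sum_bound[OF v])
  also have "\<dots> = C * v ^ (j - 2)" by (simp add: C_def t_def algebra_simps)
  also have "v ^ (j - 2) = (x - 1) ^ (n - 5)"
  proof -
    have "n - 5 = 2 * (j - 2)" by (simp add: n_def)
    thus ?thesis by (simp only: v_def power_mult)
  qed
  finally show ?thesis .
qed

lemma C_ge: "C \<ge> 3"
  unfolding C_def using c_ge by (intro add_increasing sum_nonneg) auto

section \<open>The tuples and the threshold for \<open>x\<close>\<close>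

definition tuple :: "int \<Rightarrow> int list" where
  "tuple x = [x ^ n, - ((x - 2) ^ n), - (2 * int n * q x ^ j), w x, c]"

text \<open>The square makes \<open>g\<close> exceed 1 whatever the sign of
  \<open>N\<close>.\<close>

definition g :: int where "g = 1 + N\<^sup>2"

definition A :: int where "A = 2 * int n * (1 + \<beta>) ^ j"

text \<open>The first summand serves the two domination estimates, the second absorbs the constants
  in the radical bound, and the last gives \<open>x \<ge> 3\<close>.\<close>

definition B :: int where
  "B = 2 * (A + C + c) + g * (2 * int n * (1 + \<beta>)) * C * c + 3"

lemma g_ge: "g \<ge> 2"
proof -
  have "0 < N\<^sup>2" using N_nonzero by simp
  thus ?thesis unfolding g_def by linarith
qed

lemma g_power_cong: "[g ^ k = 1] (mod N)"
proof -
  have "[g = 1] (mod N)" by (simp add: g_def cong_iff_dvd_diff)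
  thus ?thesis using cong_pow[of g 1 N k] by simp
qed

lemma A_nonneg: "A \<ge> 0" using beta_pos by (simp add: A_def)

lemma B_ge:
  "B \<ge> 2 * (A + C + c) + 3" "B \<ge> g * (2 * int n * (1 + \<beta>)) * C * c" "B \<ge> 3"
proof -
  have "g * (2 * int n * (1 + \<beta>)) * C * c \<ge> 0"
    using g_ge beta_pos C_ge c_ge by simp
  thus "B \<ge> 2 * (A + C + c) + 3" "B \<ge> g * (2 * int n * (1 + \<beta>)) * C * c" "B \<ge> 3"
    using A_nonneg C_ge c_ge unfolding B_def by auto
qed

section \<open>Pairwise coprimality for \<open>x\<close> congruent to 1 modulo
  \<open>N\<close>\<close>

context
  fixes x :: int
  assumes x_cong: "[x = 1] (mod N)"
begin

lemma x_cong_dvd: "m dvd N \<Longrightarrow> [x = 1] (mod m)"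
  using x_cong by (rule cong_dvd_modulus)

lemma dvd_N:
  "2 dvd N" "int P dvd N" "int n dvd N" "c dvd N" "K1 dvd N" "K2 dvd N" "2 * int P dvd N"
  unfolding N_def by (auto intro: dvd_mult dvd_mult2)

text \<open>Here and in the next three lemmas, coprimality to a divisor of \<open>N\<close> is
  tested at \<open>x = 1\<close>, where \<open>x\<close>, \<open>x - 2\<close>, \<open>q x\<close>,
  \<open>w x\<close> become 1, -1, \<beta>, \<open>2 * D - c\<close>.\<close>

lemma coprime_x: "m dvd N \<Longrightarrow> coprime x m"
  using cong_imp_coprime[OF cong_sym[OF x_cong_dvd], of m] by simp

lemma coprime_x_minus_2: "m dvd N \<Longrightarrow> coprime (x - 2) m"
  using cong_imp_coprime[OF cong_sym[OF cong_diff[OF x_cong_dvd cong_refl[of 2]]], of m] by simp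

lemma coprime_qI: "m dvd N \<Longrightarrow> coprime \<beta> m \<Longrightarrow> coprime (q x) m"
  using cong_imp_coprime[OF cong_sym[OF q_cong[OF x_cong_dvd]], of m] by (simp add: q_1)

lemma coprime_wI: "m dvd N \<Longrightarrow> coprime (2 * D - c) m \<Longrightarrow> coprime (w x) m"
  using cong_imp_coprime[OF cong_sym[OF w_cong[OF x_cong_dvd]], of m] by (simp add: w_1)

lemma coprime_q_2: "coprime (q x) 2"
  using odd_beta by (intro coprime_qI dvd_N) simp

lemma coprime_q_P: "coprime (q x) (int P)"
  by (intro coprime_qI dvd_N coprime_mod_P[OF beta_mod_P]) simp

lemma coprime_q_c: "coprime (q x) c"
  using coprime_c(2) by (intro coprime_qI dvd_N) (simp add: coprime_commute)

lemma coprime_q_K2: "coprime (q x) K2"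
proof (intro coprime_qI dvd_N)
  show "coprime \<beta> K2"
    using cong_imp_coprime[OF cong_sym[OF K2_mod_beta] coprime_c(5)] by (simp add: coprime_commute)
qed

lemma coprime_w_2: "coprime (w x) 2"
  using odd_c by (intro coprime_wI dvd_N) simp

lemma coprime_w_P: "coprime (w x) (int P)"
proof (intro coprime_wI dvd_N)
  have "[2 * D - c = 2 * - 2 - - 2] (mod int P)"
    by (intro cong_diff cong_mult D_mod_P c_mod_P cong_refl)
  thus "coprime (2 * D - c) (int P)" by (intro coprime_mod_P) auto
qed

text \<open>\<open>D\<close> is -1 modulo \<open>n\<close>, so \<open>2 * D - c\<close> becomes
  \<open>- (c + 2)\<close>.\<close>

lemma coprime_w_n: "coprime (w x) (int n)"
proof (intro coprime_wI dvd_N)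
  have "[- (c + 2) = 2 * D - c] (mod int n)"
    by (simp add: cong_iff_dvd_diff D_def algebra_simps)
  thus "coprime (2 * D - c) (int n)"
    by (rule cong_imp_coprime) (simp only: coprime_minus_left_iff coprime_c(4))
qed

lemma coprime_w_c: "coprime (w x) c"
proof (intro coprime_wI dvd_N)
  have "[2 * D = 2 * D - c] (mod c)" by (simp add: cong_iff_dvd_diff)
  thus "coprime (2 * D - c) c"
    by (rule cong_imp_coprime) (use coprime_c(3) odd_c in \<open>simp add: coprime_commute\<close>)
qed

lemma coprime_w_q: "coprime (w x) (q x)"
  using cong_imp_coprime[OF cong_sym[OF w_mod_q], of x] coprime_q_K2 by (simp add: coprime_commute)

text \<open>As \<open>q\<close> is symmetric about 1, \<open>q 0 = q 2 = 2 * P\<close>, a divisor of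
  \<open>N\<close>; this settles both \<open>x\<close> and \<open>x - 2\<close>.\<close>

lemma coprime_q_x: "coprime (q x) x"
proof -
  have "[q 0 = q x] (mod x)" by (intro q_cong) (simp add: cong_iff_dvd_diff)
  moreover have "q 0 = 2 * int P" by (simp add: q_def \<beta>_def)
  ultimately show ?thesis
    using cong_imp_coprime coprime_x[OF dvd_N(7)] by (metis coprime_commute)
qed

lemma coprime_q_x_minus_2: "coprime (q x) (x - 2)"
proof -
  have "[q 2 = q x] (mod (x - 2))"
    by (intro q_cong) (metis cong_iff_dvd_diff cong_sym dvd_refl)
  moreover have "q 2 = 2 * int P" by (simp add: q_def \<beta>_def)
  ultimately show ?thesis
    using cong_imp_coprime coprime_x_minus_2[OF dvd_N(7)] by (metis coprime_commute)
qed

lemma coprime_w_x: "coprime (w x) x"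
proof -
  have "[- K1 = w x] (mod x)"
    unfolding w_0[symmetric] by (intro w_cong) (simp add: cong_iff_dvd_diff)
  moreover have "coprime (- K1) x" using coprime_x[OF dvd_N(5)] by (simp add: coprime_commute)
  ultimately show ?thesis by (rule cong_imp_coprime)
qed

lemma coprime_w_x_minus_2: "coprime (w x) (x - 2)"
proof -
  have "[- K1 = w x] (mod (x - 2))"
    unfolding w_2[symmetric] by (intro w_cong) (metis cong_iff_dvd_diff cong_sym dvd_refl)
  moreover have "coprime (- K1) (x - 2)"
    using coprime_x_minus_2[OF dvd_N(5)] by (simp add: coprime_commute)
  ultimately show ?thesis by (rule cong_imp_coprime)
qed

lemma coprime_x_x_minus_2: "coprime x (x - 2)"
proof -
  have "[2 = x] (mod (x - 2))" by (metis cong_iff_dvd_diff cong_sym dvd_refl)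
  moreover have "coprime 2 (x - 2)"
    using coprime_x_minus_2[OF dvd_N(1)] by (simp only: coprime_commute)
  ultimately show ?thesis by (rule cong_imp_coprime)
qed

section \<open>Sizes of the entries\<close>

lemma q_bounds:
  assumes "x \<ge> 2"
  shows "(x - 1)\<^sup>2 \<le> q x" "q x \<le> (1 + \<beta>) * x\<^sup>2"
proof -
  show "(x - 1)\<^sup>2 \<le> q x" using beta_pos by (simp add: q_def)
  have "(x - 1)\<^sup>2 \<le> x\<^sup>2" using assms by (intro power_mono) auto
  moreover have "\<beta> * 1 \<le> \<beta> * x\<^sup>2"
    using assms beta_pos by (intro mult_left_mono) (auto simp: one_le_power)
  ultimately show "q x \<le> (1 + \<beta>) * x\<^sup>2" by (simp add: q_def algebra_simps)
qed

lemma tuple_sizes: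
  assumes "x \<ge> B"
  shows "2 * (\<bar>2 * int n * q x ^ j\<bar> + \<bar>w x\<bar> + \<bar>c\<bar>) < x ^ n"
    and "2 * (\<bar>w x\<bar> + \<bar>c\<bar>) < \<bar>2 * int n * q x ^ j\<bar>"
    and "g * (x - 2) * (2 * int n * q x) * \<bar>w x\<bar> * c \<le> x ^ (n - 1)"
proof -
  have x: "x \<ge> 2 * (A + C + c) + 3" "x \<ge> 3"
    using assms B_ge by linarith+
  note qb = q_bounds[OF order.trans[OF _ x(2)]]
  have q0: "q x \<ge> 0" using qb(1) zero_le_power2[of "x - 1"] by linarith
  have n1: "n - 1 = 2 * j" "n = Suc (n - 1)" "n - 1 = (n - 5) + 4" "n - 2 = (n - 5) + 3"
    "n - 1 = Suc (n - 2)"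
    using n_ge by (auto simp: n_def)
  have "q x ^ j \<le> ((1 + \<beta>) * x\<^sup>2) ^ j" using q0 qb(2) by (intro power_mono) auto
  also have "\<dots> = (1 + \<beta>) ^ j * x ^ (n - 1)" by (simp only: n1(1) power_mult_distrib power_mult)
  finally have a3: "\<bar>2 * int n * q x ^ j\<bar> \<le> A * x ^ (n - 1)"
    unfolding A_def using mult_left_mono[of "q x ^ j" "(1 + \<beta>) ^ j * x ^ (n - 1)" "2 * int n"] q0
    by (simp add: abs_mult mult.assoc)
  have w: "\<bar>w x\<bar> \<le> C * (x - 1) ^ (n - 5)" using x(2) by (intro w_bound) simp
  also have "\<dots> \<le> C * x ^ (n - 5)" using x(2) C_ge by (intro mult_left_mono power_mono) auto
  finally have w': "\<bar>w x\<bar> \<le> C * x ^ (n - 5)" .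
  also have "\<dots> \<le> C * x ^ (n - 1)" using x(2) C_ge by (intro mult_left_mono power_increasing) auto
  finally have w'': "\<bar>w x\<bar> \<le> C * x ^ (n - 1)" .
  have c1: "\<bar>c\<bar> \<le> c * x ^ (n - 1)"
    using mult_left_mono[of 1 "x ^ (n - 1)" c] x(2) c_ge by (simp add: one_le_power)
  have "2 * (\<bar>2 * int n * q x ^ j\<bar> + \<bar>w x\<bar> + \<bar>c\<bar>)
      \<le> 2 * (A * x ^ (n - 1) + C * x ^ (n - 1) + c * x ^ (n - 1))"
    by (intro mult_left_mono add_mono a3 w'' c1) simp
  also have "\<dots> = (2 * (A + C + c)) * x ^ (n - 1)" by (simp only: distrib_right mult.assoc)
  also have "\<dots> < x * x ^ (n - 1)" using x by (intro mult_strict_right_mono) auto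
  also have "\<dots> = x ^ n" using n1(2) by (metis power_Suc)
  finally show "2 * (\<bar>2 * int n * q x ^ j\<bar> + \<bar>w x\<bar> + \<bar>c\<bar>) < x ^ n" .

  \<comment> \<open>The lower bound for \<open>q x\<close> is a power of \<open>x - 1\<close>, so
    \<open>w x\<close> is now compared with powers of \<open>x - 1\<close> instead of
    \<open>x\<close>.\<close>
  let ?v = "(x - 1) ^ (n - 5)"
  have v: "?v \<ge> 1" using x(2) by (simp add: one_le_power)
  have c2: "\<bar>c\<bar> \<le> c * ?v" using mult_left_mono[of 1 ?v c] v c_ge by simp
  have "2 * (\<bar>w x\<bar> + \<bar>c\<bar>) \<le> 2 * (C * ?v + c * ?v)"
    by (intro mult_left_mono add_mono w c2) simp
  also have "\<dots> = (2 * (C + c)) * ?v" by (simp only: distrib_right mult.assoc)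
  also have "\<dots> < (x - 1) * ?v" using x A_nonneg v by (intro mult_strict_right_mono) auto
  also have "\<dots> \<le> (x - 1) ^ 4 * ?v"
    using x(2) v power_increasing[of 1 4 "x - 1"] by (intro mult_right_mono) auto
  also have "\<dots> = ((x - 1)\<^sup>2) ^ j"
    unfolding power_mult[symmetric] n1(1)[symmetric] n1(3) power_add by simp
  also have "\<dots> \<le> q x ^ j" using qb(1) by (intro power_mono) auto
  also have "\<dots> \<le> (2 * int n) * q x ^ j"
    using mult_right_mono[of 1 "2 * int n" "q x ^ j"] n_ge q0 by simp
  also have "\<dots> = \<bar>2 * int n * q x ^ j\<bar>" using q0 by simp
  finally show "2 * (\<bar>w x\<bar> + \<bar>c\<bar>) < \<bar>2 * int n * q x ^ j\<bar>" .

  have "g * (x - 2) * (2 * int n * q x) * \<bar>w x\<bar> * c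
      \<le> g * x * (2 * int n * ((1 + \<beta>) * x\<^sup>2)) * (C * x ^ (n - 5)) * c"
    using g_ge x(2) qb(2) q0 w' c_ge C_ge beta_pos
    by (intro mult_mono mult_nonneg_nonneg) auto
  also have "\<dots> = g * (2 * int n * (1 + \<beta>)) * C * c * x ^ (n - 2)"
    unfolding n1(4) power_add by (simp add: power2_eq_square power3_eq_cube)
  \<comment> \<open>The degrees add up to \<open>1 + 2 + (n - 5) = n - 2\<close>; one spare factor
    \<open>x\<close> beats the constants by the second summand of \<open>B\<close>.\<close>
  also have "\<dots> \<le> x * x ^ (n - 2)"
    using B_ge(2) assms x(2) by (intro mult_right_mono) auto
  also have "\<dots> = x ^ (n - 1)" by (simp only: n1(5) power_Suc)
  finally show "g * (x - 2) * (2 * int n * q x) * \<bar>w x\<bar> * c \<le> x ^ (n - 1)" .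
qed

section \<open>Membership and quality of the tuples\<close>

lemma tuple_in_U:
  assumes "x \<ge> B"
    and F: "\<And>f. f \<in> F \<Longrightarrow> 4 dvd f \<or> (\<exists>m>1. m dvd f \<and> m dvd P)"
  shows "tuple x \<in> U F 5"
  unfolding tuple_def
proof (rule in_U_5I)
  note cop = coprime_x coprime_x_minus_2 dvd_N coprime_x_x_minus_2
  note iffs = coprime_mult_left_iff coprime_mult_right_iff coprime_power_left_iff
    coprime_power_right_iff coprime_minus_left_iff coprime_minus_right_iff
  have cc: "coprime c 2" "coprime 2 c" using odd_c by auto
  have sym: "coprime b a" if "coprime a b" for a b :: int
    using that by (simp only: coprime_commute)
  show "coprime (x ^ n) (- ((x - 2) ^ n))" by (simp only: iffs cop) simp
  show "coprime (x ^ n) (- (2 * int n * q x ^ j))" by (simp only: iffs cop sym[OF coprime_q_x]) simp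
  show "coprime (x ^ n) (w x)" by (simp only: iffs sym[OF coprime_w_x]) simp
  show "coprime (x ^ n) c" by (simp only: iffs cop) simp
  show "coprime (- ((x - 2) ^ n)) (- (2 * int n * q x ^ j))"
    by (simp only: iffs cop sym[OF coprime_q_x_minus_2]) simp
  show "coprime (- ((x - 2) ^ n)) (w x)" by (simp only: iffs sym[OF coprime_w_x_minus_2]) simp
  show "coprime (- ((x - 2) ^ n)) c" by (simp only: iffs cop) simp
  show "coprime (- (2 * int n * q x ^ j)) (w x)"
    by (simp only: iffs sym[OF coprime_w_2] sym[OF coprime_w_n] sym[OF coprime_w_q]) simp
  show "coprime (- (2 * int n * q x ^ j)) c"
    by (simp only: iffs cc sym[OF coprime_c(1)] coprime_q_c) simp
  show "coprime (w x) c" by (rule coprime_w_c)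
  show "x ^ n + - ((x - 2) ^ n) + - (2 * int n * q x ^ j) + w x + c = 0" by (simp add: w_def)
  have "x \<ge> 0" using assms(1) B_ge(3) by simp
  thus "2 * (\<bar>- (2 * int n * q x ^ j)\<bar> + \<bar>w x\<bar> + \<bar>c\<bar>) < \<bar>x ^ n\<bar>"
    using tuple_sizes(1)[OF assms(1)] by simp
  show "2 * (\<bar>w x\<bar> + \<bar>c\<bar>) < \<bar>- (2 * int n * q x ^ j)\<bar>"
    using tuple_sizes(2)[OF assms(1)] by simp
  show "3 \<le> \<bar>c\<bar>" using c_ge by simp
  fix f z
  assume f: "f \<in> F" and z: "z \<in> {x ^ n, - ((x - 2) ^ n), - (2 * int n * q x ^ j), w x, c}"
  have nP: "coprime (int n) (int P)" by (rule coprime_mod_P[OF n_mod_P]) simp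
  have cP: "coprime c (int P)" by (rule coprime_mod_P[OF c_mod_P]) simp
  have "coprime 2 (int P)" using odd_P by simp
  with nP cP z have zP: "coprime z (int P)"
    using coprime_x[OF dvd_N(2)] coprime_x_minus_2[OF dvd_N(2)] coprime_q_P coprime_w_P
    by (auto simp only: iffs insert_iff empty_iff)
  \<comment> \<open>The third entry is twice an odd number and all others are odd.\<close>
  have z4: "\<not> 4 dvd z"
  proof (cases "z = - (2 * int n * q x ^ j)")
    case True
    have "odd (int n * q x ^ j)" using odd_n coprime_q_2 by simp
    hence "\<not> 2 * 2 dvd 2 * (int n * q x ^ j)" by (simp only: dvd_mult_cancel_left) simp
    thus ?thesis using True by (simp add: mult.assoc)
  next
    case False
    hence "odd z" using z odd_c coprime_x[OF dvd_N(1)] coprime_x_minus_2[OF dvd_N(1)] coprime_w_2 by auto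
    thus ?thesis by (meson dvd_trans even_numeral)
  qed
  show "\<not> int f dvd z"
  proof
    assume fz: "int f dvd z"
    from F[OF f] show False
    proof
      assume "4 dvd f"
      hence "int 4 dvd int f" by (simp only: int_dvd_int_iff)
      thus False using fz z4 dvd_trans by (metis of_nat_numeral)
    next
      assume "\<exists>m>1. m dvd f \<and> m dvd P"
      then obtain m where m: "m > 1" "int m dvd int f" "int m dvd int P" by auto
      hence "is_unit (int m)" using fz zP coprime_common_divisor dvd_trans by metis
      thus False using m(1) by simp
    qed
  qed
qed

text \<open>The maximum is at least \<open>x ^ n\<close> and the radical at most
  \<open>x ^ (n - 1)\<close>; the factor \<open>ln x\<close> cancels in the quotient of
  logarithms.\<close>

lemma tuple_quality:
  assumes "x \<ge> B" and xg: "\<And>p. prime p \<Longrightarrow> p dvd x \<Longrightarrow> p dvd g"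
  shows "real n / (real n - 1) \<le> quality (tuple x)"
proof -
  have x: "x \<ge> 3" using assms(1) B_ge(3) by linarith
  let ?R = "prod_list (tuple x)"
  \<comment> \<open>The constant \<open>g\<close> replaces \<open>x ^ n\<close>, as it contains all
    primes of \<open>x\<close>; the other powers enter through their bases.\<close>
  let ?M = "g * (x - 2) * (2 * int n * q x) * w x * c"
  \<comment> \<open>Forbidding no divisors is enough to learn that no entry vanishes.\<close>
  have "tuple x \<in> U {} 5" by (rule tuple_in_U[OF assms(1)]) simp
  hence nz: "\<forall>k<5. tuple x ! k \<noteq> 0" using U_nth_nonzero by auto
  hence R: "?R \<noteq> 0" unfolding all_less_5 by (auto simp: tuple_def)
  have qw: "q x \<noteq> 0" "w x \<noteq> 0" using nz n_ge j_ge unfolding all_less_5 by (auto simp: tuple_def)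
  have q0: "q x \<ge> 0" using q_bounds(1) x zero_le_power2[of "x - 1"] by linarith
  have "rad ?R \<le> \<bar>?M\<bar>"
  proof (rule rad_le[OF R])
    show "?M \<noteq> 0" using g_ge x qw c_ge n_ge by auto
    fix p :: int assume p: "prime p" "p dvd ?R"
    hence "p dvd x \<or> p dvd x - 2 \<or> p dvd 2 \<or> p dvd int n \<or> p dvd q x \<or> p dvd w x \<or> p dvd c"
      by (auto simp: tuple_def prime_dvd_mult_iff dest: prime_dvd_power)
    thus "p dvd ?M" using xg[OF p(1)] by (auto intro: dvd_mult dvd_mult2)
  qed
  also have "\<bar>?M\<bar> = g * (x - 2) * (2 * int n * q x) * \<bar>w x\<bar> * c"
    using g_ge x q0 c_ge by (simp add: abs_mult)
  also have "\<dots> \<le> x ^ (n - 1)" by (rule tuple_sizes(3)[OF assms(1)])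
  finally have upper: "rad ?R \<le> x ^ (n - 1)" .
  \<comment> \<open>The even third entry forces the radical to be at least 2, so its logarithm is
    positive.\<close>
  have "2 dvd ?R" by (simp add: tuple_def)
  hence lower: "2 \<le> rad ?R" by (intro rad_properties(4)[OF R] squarefree_prime) auto
  have "x ^ n \<le> Max (abs ` set (tuple x))"
    using x by (intro Max_ge) (auto simp: tuple_def)
  hence "ln (real_of_int (x ^ n)) \<le> ln (real_of_int (Max (abs ` set (tuple x))))"
    using x by (subst ln_le_cancel_iff) (auto intro: less_le_trans[of 0 "x ^ n"])
  hence num: "real n * ln (real_of_int x) \<le> ln (real_of_int (Max (abs ` set (tuple x))))"
    using x by (simp add: ln_realpow)
  have "ln (real_of_int (rad ?R)) \<le> ln (real_of_int (x ^ (n - 1)))"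
    using lower upper x by (subst ln_le_cancel_iff) (auto simp del: of_int_power)
  also have "\<dots> = (real n - 1) * ln (real_of_int x)"
    using x n_ge by (simp add: ln_realpow of_nat_diff)
  finally have den: "ln (real_of_int (rad ?R)) \<le> (real n - 1) * ln (real_of_int x)" .
  have den_pos: "0 < ln (real_of_int (rad ?R))" using lower by simp
  have lnx: "0 < ln (real_of_int x)" using x by simp
  have "real n / (real n - 1) = (real n * ln (real_of_int x)) / ((real n - 1) * ln (real_of_int x))"
    using lnx by simp
  also have "\<dots> \<le> quality (tuple x)"
    unfolding quality_def
  proof (rule frac_le[OF _ num den_pos den])
    have "0 \<le> real n * ln (real_of_int x)" using lnx by simp
    thus "0 \<le> ln (real_of_int (Max (abs ` set (tuple x))))" using num by (rule order.trans)
  qed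
  finally show ?thesis .
qed

end

section \<open>The limit superior\<close>

lemma limsup_quality_U_gt_1:
  assumes "\<And>f. f \<in> F \<Longrightarrow> 4 dvd f \<or> (\<exists>m>1. m dvd f \<and> m dvd P)"
  shows "limsup_quality (U F 5) > 1"
proof -
  \<comment> \<open>The shift by \<open>nat B\<close> puts every power beyond the threshold, since
    \<open>g ^ m > m\<close>.\<close>
  define X where "X k = g ^ (k + nat B)" for k :: nat
  have gt: "int m < g ^ m" for m
    using less_exp[of m] power_mono[of 2 g m] g_ge
    by (metis of_nat_less_iff of_nat_numeral of_nat_power order.strict_trans2 zero_le_numeral)
  have XB: "X k \<ge> B" for k using gt[of "k + nat B"] unfolding X_def by linarith
  have Xc: "[X k = 1] (mod N)" for k unfolding X_def by (rule g_power_cong)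
  have inj: "inj (\<lambda>k. tuple (X k))"
  proof (rule injI)
    fix k l assume "tuple (X k) = tuple (X l)"
    hence "X k ^ n = X l ^ n" by (simp add: tuple_def)
    hence "g ^ ((k + nat B) * n) = g ^ ((l + nat B) * n)" by (simp add: X_def power_mult)
    thus "k = l" using g_ge n_ge by (simp add: power_inject_exp)
  qed
  have "ereal (real n / (real n - 1)) \<le> (SUP a\<in>U F 5 - S. ereal (quality a))"
    if S: "finite S" for S
  proof -
    \<comment> \<open>A finite \<open>S\<close> misses one of infinitely many tuples, all of quality
      at least the same bound above 1.\<close>
    have "infinite (range (\<lambda>k. tuple (X k)))" using inj by (rule range_inj_infinite)
    then obtain k where k: "tuple (X k) \<notin> S" using S finite_subset by (metis image_subsetI)
    hence "tuple (X k) \<in> U F 5 - S" using tuple_in_U[OF Xc XB assms] by blast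
    moreover have "real n / (real n - 1) \<le> quality (tuple (X k))"
      by (rule tuple_quality[OF Xc XB]) (auto simp: X_def dest: prime_dvd_power)
    ultimately show ?thesis by (intro SUP_upper2[where i = "tuple (X k)"]) auto
  qed
  hence "ereal (real n / (real n - 1)) \<le> limsup_quality (U F 5)"
    unfolding limsup_quality_def by (intro INF_greatest) auto
  moreover have "1 < ereal (real n / (real n - 1))" using n_ge by simp
  ultimately show ?thesis by (rule less_le_trans[rotated])
qed

end

theorem theorem2p3:
  fixes F :: "nat set"
  assumes "finite F" and "F \<noteq> {}" and "Min F \<ge> 3"
  shows "limsup_quality (U F 5) > 1"
proof -
  \<comment> \<open>An odd number divisible by every odd number up to \<open>Max F\<close>.\<close>
  define P where "P = \<Prod>{m. odd m \<and> m \<le> Max F}"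
  have fin: "finite {m. odd m \<and> m \<le> Max F}" by simp
  have "odd P" unfolding P_def using fin by (auto simp: even_prod_iff)
  then interpret coprime_family P by unfold_locales
  show ?thesis
  proof (rule limsup_quality_U_gt_1)
    fix f assume f: "f \<in> F"
    have f3: "f \<ge> 3" "f \<le> Max F" using assms f Min_le[OF assms(1) f] by auto
    have dvd_P: "m dvd P" if "odd m" "m \<le> Max F" for m
      unfolding P_def using fin that by (intro dvd_prodI) auto
    \<comment> \<open>In the last case \<open>f \<ge> 3\<close> excludes \<open>m = 1\<close>, so
      \<open>m\<close> is a nontrivial common factor of \<open>f\<close> and
      \<open>P\<close>.\<close>
    consider "4 dvd f" | "odd f" | m where "f = 2 * m" "odd m"
    proof (cases "even f")
      case True
      then obtain m where m: "f = 2 * m" by auto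
      moreover have "4 dvd f" if "even m" using that m by auto
      ultimately show ?thesis using that by blast
    qed (use that in blast)
    thus "4 dvd f \<or> (\<exists>m>1. m dvd f \<and> m dvd P)"
    proof cases
      case 2
      thus ?thesis using f3 dvd_P[of f] by (intro disjI2 exI[of _ f]) auto
    next
      case (3 m)
      thus ?thesis using f3 dvd_P[of m] by (intro disjI2 exI[of _ m]) auto
    qed simp
  qed
qed

end
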